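(* Let $T$ be a consistent RE theory, $n\ge1$, and $I:{\sf Num}\unlhd T$ an interpretation such that the pairing function $J_2$ is strongly definable in $T$ w.r.t. $I$. If $T$ is $n$-Rosser w.r.t. $I$, then $T$ is $(n+1)$-Rosser w.r.t. $I$.
   Context: $J_2:\mathbb N^2\to\mathbb N$ is a fixed recursive pairing function (bijection). ${\sf Num}$ is the theory in the language $\{\mathbf 0,\mathbf S\}$ with axioms $\overline m\neq\overline n$ for $m\neq n$, where $\overline 0=\mathbf 0$, $\overline{k+1}=\mathbf S\overline k$. An interpretation $I:{\sf Num}\unlhd T$ is a translation of the language of ${\sf Num}$ into that of $T$ such that $T$ proves totality of translated function symbols on the domain, the translations of all theorems of ${\sf Num}$ and of the equality axioms; $\overline a^I$ is the $I$-translation of $\overline a$. $J_2$ is strongly definable in $T$ w.r.t. $I$ if there is a formula $\theta(x,y,z)$ with $T\vdash\forall z[\theta(\overline a^I,\overline b^I,z)\leftrightarrow z=\overline{J_2(a,b)}^I]$ for all $a,b$. A formula $\phi(x_1,\dots,x_k)$ with exactly $k$ free variables strongly separates $k$-ary $M_1$ from $M_2$ w.r.t. $I$ if $\vec a\in M_1\Rightarrow T\vdash\phi(\overline{a_1}^I,\dots,\overline{a_k}^I)$ and $\vec a\in M_2\Rightarrow T\vdash\neg\phi(\overline{a_1}^I,\dots,\overline{a_k}^I)$. $T$ is $k$-Rosser w.r.t. $I$ if for every pair of $k$-ary RE relations $M_1,M_2$ some formula strongly separates $M_1\setminus M_2$ from $M_2\setminus M_1$ w.r.t. $I$. *)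

theory Defs
  imports "HOL-Library.Nat_Bijection"
begin

section \<open>First-order logic with equality\<close>

text \<open>
  Syntax uses de Bruijn indices. A symbol is an index together with its arity: \<open>Fn f ts\<close> applies
  the function symbol \<open>(f, length ts)\<close>, and \<open>Rel r ts\<close> the relation symbol \<open>(r, length ts)\<close>.
\<close>

datatype tm = Var nat | Fn nat "tm list"

datatype fm = Bot | Eq tm tm | Rel nat "tm list" | Imp fm fm | All fm

abbreviation Neg :: "fm \<Rightarrow> fm" where "Neg A \<equiv> Imp A Bot"
abbreviation Top :: fm where "Top \<equiv> Neg Bot"
abbreviation And :: "fm \<Rightarrow> fm \<Rightarrow> fm" where "And A B \<equiv> Neg (Imp A (Neg B))"
abbreviation Iff :: "fm \<Rightarrow> fm \<Rightarrow> fm" where "Iff A B \<equiv> And (Imp A B) (Imp B A)"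
abbreviation Ex :: "fm \<Rightarrow> fm" where "Ex A \<equiv> Neg (All (Neg A))"

definition Conjs :: "fm list \<Rightarrow> fm" where "Conjs As = foldr And As Top"
definition Alls :: "nat \<Rightarrow> fm \<Rightarrow> fm" where "Alls k A = (All ^^ k) A"
definition Exs :: "nat \<Rightarrow> fm \<Rightarrow> fm" where "Exs k A = ((\<lambda>B. Ex B) ^^ k) A"

primrec fv_tm :: "tm \<Rightarrow> nat set" where
  "fv_tm (Var i) = {i}"
| "fv_tm (Fn f ts) = \<Union> (set (map fv_tm ts))"

primrec fv :: "fm \<Rightarrow> nat set" where
  "fv Bot = {}"
| "fv (Eq s t) = fv_tm s \<union> fv_tm t"
| "fv (Rel r ts) = \<Union> (set (map fv_tm ts))"
| "fv (Imp A B) = fv A \<union> fv B"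
| "fv (All A) = {i. Suc i \<in> fv A}"

primrec sub_tm :: "(nat \<Rightarrow> tm) \<Rightarrow> tm \<Rightarrow> tm" where
  "sub_tm \<sigma> (Var i) = \<sigma> i"
| "sub_tm \<sigma> (Fn f ts) = Fn f (map (sub_tm \<sigma>) ts)"

abbreviation shift :: "nat \<Rightarrow> tm" where "shift \<equiv> (\<lambda>i. Var (Suc i))"

definition up :: "(nat \<Rightarrow> tm) \<Rightarrow> nat \<Rightarrow> tm" where
  "up \<sigma> i = (case i of 0 \<Rightarrow> Var 0 | Suc j \<Rightarrow> sub_tm shift (\<sigma> j))"

primrec sub :: "(nat \<Rightarrow> tm) \<Rightarrow> fm \<Rightarrow> fm" where
  "sub \<sigma> Bot = Bot"
| "sub \<sigma> (Eq s t) = Eq (sub_tm \<sigma> s) (sub_tm \<sigma> t)"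
| "sub \<sigma> (Rel r ts) = Rel r (map (sub_tm \<sigma>) ts)"
| "sub \<sigma> (Imp A B) = Imp (sub \<sigma> A) (sub \<sigma> B)"
| "sub \<sigma> (All A) = All (sub (up \<sigma>) A)"

definition inst :: "tm \<Rightarrow> nat \<Rightarrow> tm" where
  "inst t i = (case i of 0 \<Rightarrow> t | Suc j \<Rightarrow> Var j)"

record lang =
  funs :: "(nat \<times> nat) set"
  rels :: "(nat \<times> nat) set"

primrec tm_in :: "lang \<Rightarrow> tm \<Rightarrow> bool" where
  "tm_in L (Var i) = True"
| "tm_in L (Fn f ts) = ((f, length ts) \<in> funs L \<and> list_all (\<lambda>b. b) (map (tm_in L) ts))"

primrec fm_in :: "lang \<Rightarrow> fm \<Rightarrow> bool" where
  "fm_in L Bot = True"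
| "fm_in L (Eq s t) = (tm_in L s \<and> tm_in L t)"
| "fm_in L (Rel r ts) = ((r, length ts) \<in> rels L \<and> list_all (tm_in L) ts)"
| "fm_in L (Imp A B) = (fm_in L A \<and> fm_in L B)"
| "fm_in L (All A) = fm_in L A"

definition sentence :: "lang \<Rightarrow> fm \<Rightarrow> bool" where
  "sentence L A \<longleftrightarrow> fm_in L A \<and> fv A = {}"

text \<open>
  Classical natural deduction inside the language \<open>L\<close>. In \<open>AllI\<close> the hypotheses are shifted, so
  that the new variable \<open>0\<close> is not free in them.
\<close>

inductive deriv :: "lang \<Rightarrow> fm set \<Rightarrow> fm \<Rightarrow> bool" for L :: lang where
  Assm: "A \<in> \<Gamma> \<Longrightarrow> fm_in L A \<Longrightarrow> deriv L \<Gamma> A"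
| ImpI: "fm_in L A \<Longrightarrow> deriv L (insert A \<Gamma>) B \<Longrightarrow> deriv L \<Gamma> (Imp A B)"
| ImpE: "deriv L \<Gamma> (Imp A B) \<Longrightarrow> deriv L \<Gamma> A \<Longrightarrow> deriv L \<Gamma> B"
| Classical: "fm_in L A \<Longrightarrow> deriv L (insert (Neg A) \<Gamma>) Bot \<Longrightarrow> deriv L \<Gamma> A"
| AllI: "deriv L (sub shift ` \<Gamma>) A \<Longrightarrow> deriv L \<Gamma> (All A)"
| AllE: "deriv L \<Gamma> (All A) \<Longrightarrow> tm_in L t \<Longrightarrow> deriv L \<Gamma> (sub (inst t) A)"
| EqRefl: "tm_in L t \<Longrightarrow> deriv L \<Gamma> (Eq t t)"
| EqSubst: "deriv L \<Gamma> (Eq s t) \<Longrightarrow> deriv L \<Gamma> (sub (inst s) A) \<Longrightarrow> deriv L \<Gamma> (sub (inst t) A)"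

record thy =
  lang_of :: lang
  axs :: "fm set"

definition is_thy :: "thy \<Rightarrow> bool" where
  "is_thy T \<longleftrightarrow> (\<forall>A \<in> axs T. sentence (lang_of T) A)"

definition proves :: "thy \<Rightarrow> fm \<Rightarrow> bool" (infix "\<turnstile>" 50) where
  "T \<turnstile> A \<longleftrightarrow> deriv (lang_of T) (axs T) A"

definition consistent :: "thy \<Rightarrow> bool" where
  "consistent T \<longleftrightarrow> \<not> T \<turnstile> Bot"


section \<open>Recursive functions and RE relations\<close>

datatype recf = Zero | Succ | Proj nat | Comp recf "recf list" | PRec recf recf | Mu recf

text \<open>
  \<open>ev f xs y\<close>: the \<open>\<mu>\<close>-recursive scheme \<open>f\<close> converges on the arguments \<open>xs\<close> with value \<open>y\<close>.
  Schemes carry no arity: \<open>Zero\<close> and \<open>Proj\<close> ignore superfluous arguments, and where no rule fits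
  the number of arguments the scheme diverges.
\<close>

inductive ev :: "recf \<Rightarrow> nat list \<Rightarrow> nat \<Rightarrow> bool" where
  "ev Zero xs 0"
| "ev Succ [x] (Suc x)"
| "i < length xs \<Longrightarrow> ev (Proj i) xs (xs ! i)"
| "list_all2 (\<lambda>g y. ev g xs y) gs ys \<Longrightarrow> ev f ys z \<Longrightarrow> ev (Comp f gs) xs z"
| "ev f xs y \<Longrightarrow> ev (PRec f g) (0 # xs) y"
| "ev (PRec f g) (m # xs) y \<Longrightarrow> ev g (m # y # xs) z \<Longrightarrow> ev (PRec f g) (Suc m # xs) z"
| "ev f (m # xs) 0 \<Longrightarrow> (\<forall>i<m. \<exists>y. ev f (i # xs) (Suc y)) \<Longrightarrow> ev (Mu f) xs m"

definition recursive2 :: "(nat \<Rightarrow> nat \<Rightarrow> nat) \<Rightarrow> bool" where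
  "recursive2 F \<longleftrightarrow> (\<exists>f. \<forall>a b c. ev f [a, b] c \<longleftrightarrow> c = F a b)"

text \<open>\<open>k\<close>-ary relations on the natural numbers are sets of lists of length \<open>k\<close>.\<close>

definition RE :: "nat \<Rightarrow> nat list set \<Rightarrow> bool" where
  "RE k M \<longleftrightarrow> (\<forall>xs \<in> M. length xs = k) \<and>
     (\<exists>f. \<forall>xs. length xs = k \<longrightarrow> (xs \<in> M \<longleftrightarrow> (\<exists>y. ev f xs y)))"

primrec gn_tm :: "tm \<Rightarrow> nat" where
  "gn_tm (Var i) = prod_encode (0, i)"
| "gn_tm (Fn f ts) = prod_encode (1, prod_encode (f, list_encode (map gn_tm ts)))"

primrec gn :: "fm \<Rightarrow> nat" where
  "gn Bot = prod_encode (0, 0)"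
| "gn (Eq s t) = prod_encode (1, prod_encode (gn_tm s, gn_tm t))"
| "gn (Rel r ts) = prod_encode (2, prod_encode (r, list_encode (map gn_tm ts)))"
| "gn (Imp A B) = prod_encode (3, prod_encode (gn A, gn B))"
| "gn (All A) = prod_encode (4, gn A)"

definition RE_thy :: "thy \<Rightarrow> bool" where
  "RE_thy T \<longleftrightarrow> RE 1 {[gn A] | A. A \<in> axs T}"


section \<open>Translations and interpretations\<close>

text \<open>
  One-dimensional, parameter-free, relativized translations; equality need not be translated to
  equality. In \<open>relI (r, k)\<close> the arguments are the variables \<open>0, \<dots>, k - 1\<close>; in \<open>funI (f, k)\<close> the
  arguments are \<open>0, \<dots>, k - 1\<close> and the value is \<open>k\<close>.
\<close>

record transl =
  domI :: fm
  eqI :: fm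
  funI :: "nat \<times> nat \<Rightarrow> fm"
  relI :: "nat \<times> nat \<Rightarrow> fm"

definition is_transl :: "transl \<Rightarrow> lang \<Rightarrow> lang \<Rightarrow> bool" where
  "is_transl I L1 L2 \<longleftrightarrow>
     fm_in L2 (domI I) \<and> fv (domI I) \<subseteq> {0} \<and>
     fm_in L2 (eqI I) \<and> fv (eqI I) \<subseteq> {0, 1} \<and>
     (\<forall>(f, k) \<in> funs L1. fm_in L2 (funI I (f, k)) \<and> fv (funI I (f, k)) \<subseteq> {..k}) \<and>
     (\<forall>(r, k) \<in> rels L1. fm_in L2 (relI I (r, k)) \<and> fv (relI I (r, k)) \<subseteq> {..<k})"

definition dom_at :: "transl \<Rightarrow> nat \<Rightarrow> fm" where
  "dom_at I i = sub (\<lambda>_. Var i) (domI I)"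

text \<open>
  \<open>bind_args I c Vs A\<close> is \<open>\<exists>y\<^sub>0 \<dots> y\<^sub>k\<^sub>-\<^sub>1 \<in> dom. (\<And>j<k. Vs\<^sub>j(y\<^sub>j)) \<and> A\<close>. In each \<open>Vs\<^sub>j\<close>, variable
  \<open>0\<close> is the value and variable \<open>Suc i\<close> is the ambient variable \<open>i\<close>. In the matrix, the indices
  below \<open>k\<close> are the \<open>y\<^sub>j\<close>, the next \<open>c\<close> indices are reserved for \<open>A\<close>, and the ambient variables
  follow.
\<close>

definition bind_args :: "transl \<Rightarrow> nat \<Rightarrow> fm list \<Rightarrow> fm \<Rightarrow> fm" where
  "bind_args I c Vs A = (let k = length Vs in
     Exs k (And (Conjs (map (\<lambda>j. And (dom_at I j)
         (sub (\<lambda>i. case i of 0 \<Rightarrow> Var j | Suc m \<Rightarrow> Var (k + c + m)) (Vs ! j))) [0..<k])) A))"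

text \<open>
  \<open>val I t\<close> is the translation of \<open>t = y\<close>, with \<open>y\<close> the variable \<open>0\<close> and the variables of \<open>t\<close>
  shifted by one. Unnesting introduces a new variable for every argument; for an argument that is
  already a variable the new one is identified with it by the equality of the target, so that
  \<open>f(x\<^sub>1, \<dots>, x\<^sub>k) = y\<close> becomes \<open>funI (f, k)\<close> itself, relativized to the domain.
\<close>

primrec val :: "transl \<Rightarrow> tm \<Rightarrow> fm" where
  "val I (Var i) = Eq (Var 0) (Var (Suc i))"
| "val I (Fn f ts) = bind_args I 1 (map (val I) ts) (funI I (f, length ts))"

fun tr_eq :: "transl \<Rightarrow> tm \<Rightarrow> tm \<Rightarrow> fm" where
  "tr_eq I (Var i) (Var j) = sub (\<lambda>n. if n = 0 then Var i else Var j) (eqI I)"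
| "tr_eq I s t = Ex (And (dom_at I 0) (And (val I s) (val I t)))"

primrec tr :: "transl \<Rightarrow> fm \<Rightarrow> fm" where
  "tr I Bot = Bot"
| "tr I (Eq s t) = tr_eq I s t"
| "tr I (Rel r ts) = bind_args I 0 (map (val I) ts) (relI I (r, length ts))"
| "tr I (Imp A B) = Imp (tr I A) (tr I B)"
| "tr I (All A) = All (Imp (dom_at I 0) (tr I A))"

definition total_fn :: "transl \<Rightarrow> nat \<Rightarrow> nat \<Rightarrow> fm" where
  "total_fn I f k = Alls k (Imp (Conjs (map (dom_at I) [0..<k]))
     (Ex (And (dom_at I 0)
        (sub (\<lambda>i. if i < k then Var (Suc i) else Var 0) (funI I (f, k))))))"

definition eq_axioms :: "lang \<Rightarrow> fm set" where
  "eq_axioms L =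
     {Alls 1 (Eq (Var 0) (Var 0)),
      Alls 2 (Imp (Eq (Var 0) (Var 1)) (Eq (Var 1) (Var 0))),
      Alls 3 (Imp (Eq (Var 0) (Var 1)) (Imp (Eq (Var 1) (Var 2)) (Eq (Var 0) (Var 2))))}
     \<union> {Alls (2 * k) (Imp (Conjs (map (\<lambda>i. Eq (Var i) (Var (k + i))) [0..<k]))
          (Eq (Fn f (map Var [0..<k])) (Fn f (map Var [k..<2 * k])))) | f k. (f, k) \<in> funs L}
     \<union> {Alls (2 * k) (Imp (Conjs (map (\<lambda>i. Eq (Var i) (Var (k + i))) [0..<k]))
          (Imp (Rel r (map Var [0..<k])) (Rel r (map Var [k..<2 * k])))) | r k. (r, k) \<in> rels L}"

definition interprets :: "transl \<Rightarrow> thy \<Rightarrow> thy \<Rightarrow> bool" where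
  "interprets I S T \<longleftrightarrow>
     is_transl I (lang_of S) (lang_of T) \<and>
     (\<forall>(f, k) \<in> funs (lang_of S). T \<turnstile> total_fn I f k) \<and>
     (\<forall>A. sentence (lang_of S) A \<and> S \<turnstile> A \<longrightarrow> T \<turnstile> tr I A) \<and>
     (\<forall>A \<in> eq_axioms (lang_of S). T \<turnstile> tr I A)"


section \<open>The theory Num, strong definability and Rosser theories\<close>

primrec num :: "nat \<Rightarrow> tm" where
  "num 0 = Fn 0 []"
| "num (Suc m) = Fn 1 [num m]"

definition Num :: thy where
  "Num = \<lparr>lang_of = \<lparr>funs = {(0, 0), (1, 1)}, rels = {}\<rparr>,
          axs = {Neg (Eq (num m) (num n)) | m n. m \<noteq> n}\<rparr>"

text \<open>
  \<open>plug I A [a\<^sub>1, \<dots>, a\<^sub>k]\<close> is \<open>A\<close> with the translated numerals of \<open>a\<^sub>1, \<dots>, a\<^sub>k\<close> put for the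
  variables \<open>0, \<dots>, k - 1\<close>; the remaining variables are lowered by \<open>k\<close>. The translation of a
  numeral is a formula, not a term of the target language, so it is eliminated contextually:
  \<open>A(t)\<close> stands for \<open>\<exists>x \<in> dom. (t = x)\<^sup>I \<and> A(x)\<close>.
\<close>

fun plug :: "transl \<Rightarrow> fm \<Rightarrow> nat list \<Rightarrow> fm" where
  "plug I A [] = A"
| "plug I A (a # as) = plug I (Ex (And (dom_at I 0) (And (val I (num a)) A))) as"

text \<open>In \<open>\<theta>(x, y, z)\<close> the variables \<open>x, y, z\<close> are \<open>0, 1, 2\<close>; plugging in \<open>a\<close> and \<open>b\<close> turns \<open>z\<close>
  into \<open>0\<close>. Similarly, \<open>plug I (Eq (Var 1) (Var 0)) [c]\<close> is \<open>z = c\<close> with \<open>z\<close> the variable \<open>0\<close>.\<close>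

definition strongly_definable2 :: "thy \<Rightarrow> transl \<Rightarrow> (nat \<Rightarrow> nat \<Rightarrow> nat) \<Rightarrow> bool" where
  "strongly_definable2 T I F \<longleftrightarrow>
     (\<exists>\<theta>. fm_in (lang_of T) \<theta> \<and> fv \<theta> \<subseteq> {0, 1, 2} \<and>
       (\<forall>a b. T \<turnstile> All (Iff (plug I \<theta> [a, b]) (plug I (Eq (Var 1) (Var 0)) [F a b]))))"

definition strongly_separates ::
    "thy \<Rightarrow> transl \<Rightarrow> nat \<Rightarrow> fm \<Rightarrow> nat list set \<Rightarrow> nat list set \<Rightarrow> bool" where
  "strongly_separates T I k \<phi> M1 M2 \<longleftrightarrow>
     fm_in (lang_of T) \<phi> \<and> fv \<phi> = {..<k} \<and>
     (\<forall>as \<in> M1. T \<turnstile> plug I \<phi> as) \<and>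
     (\<forall>as \<in> M2. T \<turnstile> Neg (plug I \<phi> as))"

definition Rosser :: "nat \<Rightarrow> thy \<Rightarrow> transl \<Rightarrow> bool" where
  "Rosser k T I \<longleftrightarrow>
     (\<forall>M1 M2. RE k M1 \<and> RE k M2 \<longrightarrow>
       (\<exists>\<phi>. strongly_separates T I k \<phi> (M1 - M2) (M2 - M1)))"

end

theory Submission
  imports Defs
begin

text \<open>
  Code the first two arguments of an \<open>(n + 1)\<close>-ary relation into one by the pairing function. As the
  inverse of the latter is recursive, the coded relations are RE, and as it is injective, coding
  commutes with set difference. If \<open>\<psi>\<close> separates the coded relations, then
  \<open>\<exists>z. \<theta>(x, y, z) \<and> \<psi>(z, \<dots>)\<close> separates the given ones: for numerals \<open>a, b\<close> the formula
  \<open>\<theta>(a, b, z)\<close> is provably equivalent to \<open>z = c\<close> with \<open>c\<close> the code of \<open>(a, b)\<close>, so the two formulas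
  are provably equivalent at numerals by pure logic.
\<close>

section \<open>Renaming of variables\<close>

lemma sub_tm_cong: "(\<And>i. i \<in> fv_tm t \<Longrightarrow> \<sigma> i = \<tau> i) \<Longrightarrow> sub_tm \<sigma> t = sub_tm \<tau> t"
  by (induction t) auto

lemma sub_cong: "(\<And>i. i \<in> fv A \<Longrightarrow> \<sigma> i = \<tau> i) \<Longrightarrow> sub \<sigma> A = sub \<tau> A"
proof (induction A arbitrary: \<sigma> \<tau>)
  case (Eq s t)
  then show ?case using sub_tm_cong[of s \<sigma> \<tau>] sub_tm_cong[of t \<sigma> \<tau>] by simp
next
  case (Rel r ts)
  have "sub_tm \<sigma> t = sub_tm \<tau> t" if "t \<in> set ts" for t
    by (rule sub_tm_cong, rule Rel) (use that in auto)
  then show ?case by simp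
next
  case (Imp A B)
  show ?case using Imp.IH[of \<sigma> \<tau>] Imp.prems by simp
next
  case (All A)
  have "up \<sigma> i = up \<tau> i" if "i \<in> fv A" for i
  proof (cases i)
    case (Suc j)
    then show ?thesis using that All.prems[of j] by (simp add: up_def)
  qed (simp add: up_def)
  then show ?case using All.IH[of "up \<sigma>" "up \<tau>"] by simp
qed simp

lemma sub_tm_Var [simp]: "sub_tm Var t = t"
  by (induction t) (simp_all add: map_idI)

lemma up_Var: "up Var = Var"
  by (auto simp: up_def fun_eq_iff split: nat.splits)

lemma sub_Var [simp]: "sub Var A = A"
  by (induction A) (simp_all add: map_idI up_Var)

lemma sub_closed: "fv A = {} \<Longrightarrow> sub \<sigma> A = A"
  using sub_cong[of A \<sigma> Var] by simp

lemma up_ren: "up (\<lambda>i. Var (r i)) = (\<lambda>i. Var (case i of 0 \<Rightarrow> 0 | Suc j \<Rightarrow> Suc (r j)))"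
  by (auto simp: up_def fun_eq_iff split: nat.splits)

lemma sub_tm_ren: "sub_tm \<sigma> (sub_tm (\<lambda>i. Var (r i)) t) = sub_tm (\<lambda>i. \<sigma> (r i)) t"
  by (induction t) auto

lemma up_comp_ren:
  "(\<lambda>i. up \<sigma> (case i of 0 \<Rightarrow> 0 | Suc j \<Rightarrow> Suc (r j))) = up (\<lambda>i. \<sigma> (r i))"
  by (auto simp: up_def fun_eq_iff split: nat.splits)

text \<open>The inner substitution is always a renaming below. Lifting a renaming under a binder
  gives a renaming again, so this special case of composition is closed under the induction.\<close>

lemma sub_ren: "sub \<sigma> (sub (\<lambda>i. Var (r i)) A) = sub (\<lambda>i. \<sigma> (r i)) A"
proof (induction A arbitrary: \<sigma> r)
  case (All A)
  show ?case by (simp only: sub.simps up_ren All.IH up_comp_ren)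
qed (simp_all add: sub_tm_ren)

lemma fv_tm_ren: "fv_tm (sub_tm (\<lambda>i. Var (r i)) t) = r ` fv_tm t"
  by (induction t) auto

lemma fv_ren [simp]: "fv (sub (\<lambda>i. Var (r i)) A) = r ` fv A"
proof (induction A arbitrary: r)
  case (All A)
  have "Suc x \<in> (\<lambda>i. case i of 0 \<Rightarrow> 0 | Suc j \<Rightarrow> Suc (r j)) ` F \<longleftrightarrow> x \<in> r ` {i. Suc i \<in> F}"
    for x F
  proof
    assume "Suc x \<in> (\<lambda>i. case i of 0 \<Rightarrow> 0 | Suc j \<Rightarrow> Suc (r j)) ` F"
    then obtain k where "Suc x = (case k of 0 \<Rightarrow> 0 | Suc j \<Rightarrow> Suc (r j))" "k \<in> F" by blast
    then show "x \<in> r ` {i. Suc i \<in> F}" by (cases k) auto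
  next
    assume "x \<in> r ` {i. Suc i \<in> F}"
    then obtain j where "x = r j" "Suc j \<in> F" by blast
    then show "Suc x \<in> (\<lambda>i. case i of 0 \<Rightarrow> 0 | Suc j \<Rightarrow> Suc (r j)) ` F"
      by (intro image_eqI[of _ _ "Suc j"]) auto
  qed
  then show ?case by (simp only: fv.simps sub.simps up_ren All.IH) blast
qed (auto simp: fv_tm_ren)

lemma tm_in_ren: "tm_in L (sub_tm (\<lambda>i. Var (r i)) t) = tm_in L t"
  by (induction t) (auto simp: list_all_iff)

lemma fm_in_ren [simp]: "fm_in L (sub (\<lambda>i. Var (r i)) A) = fm_in L A"
  by (induction A arbitrary: r) (simp_all add: tm_in_ren up_ren list_all_iff)

lemma inst_Var: "inst (Var k) = (\<lambda>i. Var (case i of 0 \<Rightarrow> k | Suc j \<Rightarrow> j))"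
  by (auto simp: inst_def fun_eq_iff split: nat.splits)

lemma fm_in_inst [simp]: "fm_in L (sub (inst (Var k)) A) = fm_in L A"
  by (simp add: inst_Var)

section \<open>Derived rules of natural deduction\<close>

lemma deriv_mono: "deriv L \<Gamma> A \<Longrightarrow> \<Gamma> \<subseteq> \<Delta> \<Longrightarrow> deriv L \<Delta> A"
proof (induction arbitrary: \<Delta> rule: deriv.induct)
  case (ImpI A \<Gamma> B)
  then show ?case by (meson deriv.ImpI insert_mono)
next
  case (Classical A \<Gamma>)
  then show ?case by (meson deriv.Classical insert_mono)
next
  case (AllI \<Gamma> A)
  then show ?case by (blast intro: deriv.AllI)
next
  case (EqSubst \<Gamma> s t A)
  then show ?case by (meson deriv.EqSubst)
qed (auto intro: deriv.intros)

lemma AndI: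
  assumes "deriv L \<Gamma> A" "deriv L \<Gamma> B" "fm_in L A" "fm_in L B"
  shows "deriv L \<Gamma> (And A B)"
proof (rule deriv.ImpI)
  let ?\<Delta> = "insert (Imp A (Neg B)) \<Gamma>"
  have "deriv L ?\<Delta> (Imp A (Neg B))"
    by (rule deriv.Assm) (use assms in auto)
  moreover have A: "deriv L ?\<Delta> A" and B: "deriv L ?\<Delta> B"
    using assms deriv_mono by blast+
  ultimately show "deriv L ?\<Delta> Bot"
    using deriv.ImpE[OF deriv.ImpE[OF _ A] B] by blast
qed (use assms in simp)

lemma AndE1:
  assumes "deriv L \<Gamma> (And A B)" "fm_in L A" "fm_in L B"
  shows "deriv L \<Gamma> A"
proof (rule deriv.Classical[OF assms(2)])
  let ?\<Delta> = "insert (Neg A) \<Gamma>"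
  have "deriv L (insert B (insert A ?\<Delta>)) Bot"
    by (rule deriv.ImpE[of _ _ A]; rule deriv.Assm) (use assms in auto)
  then have "deriv L ?\<Delta> (Imp A (Neg B))"
    using assms by (intro deriv.ImpI)
  moreover have "deriv L ?\<Delta> (And A B)"
    using assms deriv_mono by blast
  ultimately show "deriv L ?\<Delta> Bot"
    by (rule deriv.ImpE[rotated])
qed

lemma AndE2:
  assumes "deriv L \<Gamma> (And A B)" "fm_in L A" "fm_in L B"
  shows "deriv L \<Gamma> B"
proof (rule deriv.Classical[OF assms(3)])
  let ?\<Delta> = "insert (Neg B) \<Gamma>"
  have "deriv L ?\<Delta> (Imp A (Neg B))"
    by (rule deriv.ImpI[OF assms(2) deriv.Assm]) (use assms in auto)
  moreover have "deriv L ?\<Delta> (And A B)"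
    using assms deriv_mono by blast
  ultimately show "deriv L ?\<Delta> Bot"
    by (rule deriv.ImpE[rotated])
qed

lemma ExI:
  assumes "deriv L \<Gamma> (sub (inst t) A)" "tm_in L t" "fm_in L A"
  shows "deriv L \<Gamma> (Ex A)"
proof (rule deriv.ImpI)
  let ?\<Delta> = "insert (All (Neg A)) \<Gamma>"
  have "deriv L ?\<Delta> (sub (inst t) (Neg A))"
    using assms by (intro deriv.AllE deriv.Assm) auto
  moreover have "deriv L ?\<Delta> (sub (inst t) A)"
    using assms deriv_mono by blast
  ultimately show "deriv L ?\<Delta> Bot"
    using deriv.ImpE[of L ?\<Delta> "sub (inst t) A" Bot] by simp
qed (use assms in simp)

text \<open>\<open>Ex\<close> abbreviates a negated universal, so the rule comes from
  \<open>AllI\<close>: shifting the hypotheses frees variable 0 for the witness, and refuting every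
  witness contradicts \<open>Ex A\<close>.\<close>

lemma ExE:
  assumes "deriv L \<Gamma> (Ex A)" "deriv L (insert A (sub shift ` \<Gamma>)) (sub shift B)"
    and "fm_in L A" "fm_in L B"
  shows "deriv L \<Gamma> B"
proof (rule deriv.Classical[OF assms(4)])
  let ?\<Delta> = "insert (Neg B) \<Gamma>"
  let ?\<Theta> = "insert A (sub shift ` ?\<Delta>)"
  have "deriv L ?\<Theta> (Neg (sub shift B))"
    using assms by (intro deriv.Assm) auto
  moreover have "deriv L ?\<Theta> (sub shift B)"
    by (rule deriv_mono[OF assms(2)]) auto
  ultimately have "deriv L ?\<Theta> Bot"
    by (rule deriv.ImpE)
  then have "deriv L ?\<Delta> (All (Neg A))"
    using assms by (intro deriv.AllI deriv.ImpI)
  moreover have "deriv L ?\<Delta> (Ex A)"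
    using assms deriv_mono by blast
  ultimately show "deriv L ?\<Delta> Bot"
    by (rule deriv.ImpE[rotated])
qed

text \<open>The quantifier by which \<open>plug\<close> eliminates a numeral: \<open>D\<close> is
  the domain and \<open>V\<close> the formula that translates being equal to the numeral.\<close>

definition bex :: "fm \<Rightarrow> fm \<Rightarrow> fm \<Rightarrow> fm" where
  "bex D V A = Ex (And D (And V A))"

lemma fm_in_bex [simp]: "fm_in L (bex D V A) \<longleftrightarrow> fm_in L D \<and> fm_in L V \<and> fm_in L A"
  by (simp add: bex_def)

lemma sub_unary: "fv A \<subseteq> {0} \<Longrightarrow> sub \<sigma> A = sub (\<lambda>_. \<sigma> 0) A"
  by (rule sub_cong) auto

lemma sub_bex:
  assumes "fv D \<subseteq> {0}" "fv V \<subseteq> {0}"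
  shows "sub \<sigma> (bex D V A) = bex D V (sub (up \<sigma>) A)"
proof -
  have "sub (up \<sigma>) B = B" if "fv B \<subseteq> {0}" for B
    using that sub_unary[OF that, of "up \<sigma>"] sub_unary[OF that, of Var] by (simp add: up_def)
  then show ?thesis using assms by (simp add: bex_def)
qed

lemma bexI:
  assumes "deriv L \<Gamma> (sub (\<lambda>_. Var k) D)" "deriv L \<Gamma> (sub (\<lambda>_. Var k) V)"
    and "deriv L \<Gamma> (sub (inst (Var k)) A)"
    and "fm_in L D" "fm_in L V" "fm_in L A" "fv D \<subseteq> {0}" "fv V \<subseteq> {0}"
  shows "deriv L \<Gamma> (bex D V A)"
proof -
  have "sub (inst (Var k)) D = sub (\<lambda>_. Var k) D" "sub (inst (Var k)) V = sub (\<lambda>_. Var k) V"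
    using assms sub_unary[of _ "inst (Var k)"] by (simp_all add: inst_def)
  then show ?thesis
    unfolding bex_def using assms by (intro ExI[of _ _ "Var k"]) (auto intro!: AndI)
qed

text \<open>The conditions on the witness carry an explicit variable index, although index 0 changes
  nothing: under further quantifiers a shift then merely raises that index.\<close>

lemma bexE:
  assumes "deriv L \<Gamma> (bex D V A)"
    and der: "deriv L (insert (sub (\<lambda>_. Var 0) D) (insert (sub (\<lambda>_. Var 0) V)
      (insert A (sub shift ` \<Gamma>)))) (sub shift B)"
    and fm: "fm_in L D" "fm_in L V" "fm_in L A" "fm_in L B" and "fv D \<subseteq> {0}" "fv V \<subseteq> {0}"
  shows "deriv L \<Gamma> B"
proof (rule ExE[OF assms(1)[unfolded bex_def]])
  let ?C = "And D (And V A)"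
  let ?\<Delta> = "insert ?C (sub shift ` \<Gamma>)"
  have eq: "sub (\<lambda>_. Var 0) D = D" "sub (\<lambda>_. Var 0) V = V"
    using assms sub_unary[of _ Var] by simp_all
  have C: "deriv L ?\<Delta> ?C"
    using fm by (intro deriv.Assm) auto
  have D: "deriv L ?\<Delta> D" and VA: "deriv L ?\<Delta> (And V A)"
    using AndE1[OF C] AndE2[OF C] fm by auto
  have V: "deriv L ?\<Delta> V" and A: "deriv L ?\<Delta> A"
    using AndE1[OF VA] AndE2[OF VA] fm by auto
  have "deriv L (insert D (insert V (insert A ?\<Delta>))) (sub shift B)"
    using der by (rule deriv_mono) (auto simp: eq)
  then have "deriv L ?\<Delta> (Imp A (Imp V (Imp D (sub shift B))))"
    using fm by (intro deriv.ImpI)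
  then show "deriv L ?\<Delta> (sub shift B)"
    using deriv.ImpE[OF deriv.ImpE[OF deriv.ImpE[OF _ A] V] D] by blast
qed (use fm in auto)

text \<open>The given implication is used below the opened quantifier, where the hypotheses appear
  shifted; hence the invariance of \<Gamma>.\<close>

lemma bex_mono:
  assumes imp: "deriv L \<Gamma> (Imp A B)" and \<Gamma>: "sub shift ` \<Gamma> = \<Gamma>"
    and fm: "fm_in L D" "fm_in L V" "fm_in L A" "fm_in L B" and un: "fv D \<subseteq> {0}" "fv V \<subseteq> {0}"
  shows "deriv L \<Gamma> (Imp (bex D V A) (bex D V B))"
proof (rule deriv.ImpI)
  show fmA: "fm_in L (bex D V A)"
    by (simp add: fm)
  let ?\<Delta> = "insert (bex D V A) \<Gamma>"
  let ?\<Theta> = "insert (sub (\<lambda>_. Var 0) D) (insert (sub (\<lambda>_. Var 0) V)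
      (insert A (sub shift ` ?\<Delta>)))"
  have "deriv L ?\<Theta> (Imp A B)"
    by (rule deriv_mono[OF imp]) (use \<Gamma> in blast)
  moreover have "deriv L ?\<Theta> A"
    by (rule deriv.Assm) (simp_all add: fm)
  ultimately have B: "deriv L ?\<Theta> B"
    by (rule deriv.ImpE)
  \<comment> \<open>The witness just opened, variable 0, is reused for the shifted goal, which turns
    its body back into \<open>B\<close>.\<close>
  have "sub (inst (Var 0)) (sub (up shift) B) =
      sub (\<lambda>i. inst (Var 0) (case i of 0 \<Rightarrow> 0 | Suc j \<Rightarrow> Suc (Suc j))) B"
    by (simp only: up_ren sub_ren)
  also have "\<dots> = sub Var B"
    by (rule sub_cong) (simp add: inst_def split: nat.splits)
  finally have eq: "sub (inst (Var 0)) (sub (up shift) B) = B"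
    by simp
  have D: "deriv L ?\<Theta> (sub (\<lambda>_. Var 0) D)" and V: "deriv L ?\<Theta> (sub (\<lambda>_. Var 0) V)"
    by (rule deriv.Assm; simp add: fm)+
  have "fm_in L (sub (up shift) B)"
    by (simp add: fm up_ren)
  then have "deriv L ?\<Theta> (bex D V (sub (up shift) B))"
    using bexI[OF D V _ fm(1,2) _ un] B eq by simp
  then have "deriv L ?\<Theta> (sub shift (bex D V B))"
    by (simp only: sub_bex[OF un])
  moreover have "deriv L ?\<Delta> (bex D V A)"
    by (rule deriv.Assm[OF _ fmA]) simp
  ultimately show "deriv L ?\<Delta> (bex D V B)"
    using bexE[OF _ _ fm(1,2,3) _ un] fm by (metis fm_in_bex)
qed

section \<open>Coding two arguments into one\<close>

text \<open>Used for \<psi> below \<open>k\<close> open quantifiers: its coded argument is the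
  variable \<open>a\<close>, and its other arguments are ambient variables raised by
  \<open>k\<close>.\<close>

definition pl1 :: "nat \<Rightarrow> nat \<Rightarrow> fm \<Rightarrow> fm" where
  "pl1 a k A = sub (\<lambda>i. Var (case i of 0 \<Rightarrow> a | Suc j \<Rightarrow> j + k)) A"

text \<open>Used for \<theta>, whose free variables are among 0, 1, 2. Sending all later indices to
  \<open>z\<close> as well makes this a renaming without affecting \<theta>.\<close>

definition pl3 :: "nat \<Rightarrow> nat \<Rightarrow> nat \<Rightarrow> fm \<Rightarrow> fm" where
  "pl3 x y z A = sub (\<lambda>i. Var (case i of 0 \<Rightarrow> x | Suc j \<Rightarrow> (case j of 0 \<Rightarrow> y | Suc _ \<Rightarrow> z))) A"

lemma fm_in_pl [simp]:
  "fm_in L (pl1 a k A) = fm_in L A" "fm_in L (pl3 x y z A) = fm_in L A"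
  by (simp_all add: pl1_def pl3_def)

lemma sub_ren_cong:
  "(\<And>i. i \<in> fv A \<Longrightarrow> \<sigma> (r i) = \<tau> i) \<Longrightarrow> sub \<sigma> (sub (\<lambda>i. Var (r i)) A) = sub \<tau> A"
  unfolding sub_ren by (rule sub_cong)

lemma shift_pl1: "sub shift (pl1 a k A) = pl1 (Suc a) (Suc k) A"
  unfolding pl1_def by (rule sub_ren_cong) (simp split: nat.splits)

lemma inst_pl1: "sub (inst (Var m)) (pl1 0 (Suc k) A) = pl1 m k A"
  unfolding pl1_def by (rule sub_ren_cong) (simp add: inst_def split: nat.splits)

lemma inst_bex_Eq:
  assumes "fv D \<subseteq> {0}" "fv V \<subseteq> {0}"
  shows "sub (inst (Var z)) (bex D V (Eq (Var 1) (Var 0))) = bex D V (Eq (Var (Suc z)) (Var 0))"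
  by (simp add: sub_bex[OF assms]) (simp add: up_def inst_def)

lemma inst_bex_bex:
  assumes "fv D \<subseteq> {0}" "fv V \<subseteq> {0}" "fv W \<subseteq> {0}" "fv \<theta> \<subseteq> {0, 1, 2}"
  shows "sub (inst (Var z)) (bex D V (bex D W \<theta>)) = bex D V (bex D W (pl3 0 1 (z + 2) \<theta>))"
proof -
  have "sub (up (up (inst (Var z)))) \<theta> = pl3 0 1 (z + 2) \<theta>"
    unfolding pl3_def
    by (rule sub_cong) (use assms(4) in \<open>auto simp: inst_Var up_ren\<close>)
  then show ?thesis by (simp add: sub_bex assms)
qed

text \<open>
  The pair \<open>(x, y)\<close> of the variables \<open>0, 1\<close> is coded by the witness of \<open>Ex\<close>. The trivial equations
  are there to make \<open>0\<close> and \<open>1\<close> occur even if they do not occur in \<open>\<theta>\<close>.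
\<close>

definition uncode :: "fm \<Rightarrow> fm \<Rightarrow> fm" where
  "uncode \<theta> \<psi> = And (And (Eq (Var 0) (Var 0)) (Eq (Var 1) (Var 1)))
     (Ex (And (pl3 1 2 0 \<theta>) (pl1 0 3 \<psi>)))"

lemma fm_in_uncode [simp]: "fm_in L (uncode \<theta> \<psi>) \<longleftrightarrow> fm_in L \<theta> \<and> fm_in L \<psi>"
  by (simp add: uncode_def)

lemma fv_uncode:
  assumes "fv \<theta> \<subseteq> {0, 1, 2}" "fv \<psi> = {..<n}" "n \<ge> 1"
  shows "fv (uncode \<theta> \<psi>) = {..<n + 1}"
proof -
  have "fv (pl3 1 2 0 \<theta>) \<subseteq> {0, 1, 2}"
    using assms(1) by (auto simp: pl3_def split: nat.splits)
  \<comment> \<open>The free variables from 2 on come from \<psi>: its variable \<open>i - 1\<close>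
    becomes \<open>Suc i\<close> below the quantifier, that is \<open>i\<close> outside.\<close>
  moreover have "Suc i \<in> fv (pl1 0 3 \<psi>) \<longleftrightarrow> 2 \<le> i \<and> i < n + 1" for i
  proof
    assume "Suc i \<in> fv (pl1 0 3 \<psi>)"
    then show "2 \<le> i \<and> i < n + 1"
      by (auto simp: pl1_def assms(2) split: nat.splits)
  next
    assume "2 \<le> i \<and> i < n + 1"
    then show "Suc i \<in> fv (pl1 0 3 \<psi>)"
      unfolding pl1_def fv_ren assms(2) by (intro image_eqI[of _ _ "i - 1"]) (auto split: nat.splits)
  qed
  ultimately show ?thesis
    using assms(3) by (fastforce simp: uncode_def)
qed

text \<open>\<open>Va\<close>, \<open>Vb\<close>, \<open>Vc\<close> stand for the numerals of
  \<open>a\<close>, \<open>b\<close> and their code \<open>c\<close>. The quantifier for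
  \<open>a\<close> is innermost because \<open>plug\<close> binds the first argument first.\<close>

locale coding =
  fixes L :: lang and \<Gamma> :: "fm set" and D Va Vb Vc \<theta> \<psi> :: fm
  assumes \<Gamma>: "sub shift ` \<Gamma> = \<Gamma>"
    and fm: "fm_in L D" "fm_in L Va" "fm_in L Vb" "fm_in L Vc" "fm_in L \<theta>" "fm_in L \<psi>"
    and un: "fv D \<subseteq> {0}" "fv Va \<subseteq> {0}" "fv Vb \<subseteq> {0}" "fv Vc \<subseteq> {0}"
    and fv_\<theta>: "fv \<theta> \<subseteq> {0, 1, 2}"
    and def: "deriv L \<Gamma> (All (Iff (bex D Vb (bex D Va \<theta>)) (bex D Vc (Eq (Var 1) (Var 0)))))"
begin

lemma inst_def_iff:
  assumes "\<Gamma> \<subseteq> \<Delta>"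
  shows "deriv L \<Delta> (bex D Vb (bex D Va (pl3 0 1 (z + 2) \<theta>))) \<longleftrightarrow>
    deriv L \<Delta> (bex D Vc (Eq (Var (Suc z)) (Var 0)))" (is "deriv L \<Delta> ?A \<longleftrightarrow> deriv L \<Delta> ?B")
proof -
  have "deriv L \<Gamma> (sub (inst (Var z))
      (Iff (bex D Vb (bex D Va \<theta>)) (bex D Vc (Eq (Var 1) (Var 0)))))"
    by (rule deriv.AllE[OF def]) simp
  then have "deriv L \<Gamma> (Iff ?A ?B)"
    by (simp only: sub.simps inst_bex_Eq[OF un(1,4)] inst_bex_bex[OF un(1,3,2) fv_\<theta>])
  then have iff: "deriv L \<Delta> (Iff ?A ?B)"
    using assms by (rule deriv_mono)
  have "deriv L \<Delta> (Imp ?A ?B)" "deriv L \<Delta> (Imp ?B ?A)"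
    by (rule AndE1[OF iff] AndE2[OF iff]; simp add: fm)+
  then show ?thesis by (blast intro: deriv.ImpE)
qed

text \<open>Opening the quantifiers yields \<open>y\<close>, \<open>x\<close> and a code
  \<open>z\<close> with \<theta>(x, y, z) and \<psi>(z). By definability \<open>z\<close> equals
  some \<open>w\<close> that is a value of the numeral of \<open>c\<close>, and \<psi> passes from
  \<open>z\<close> to \<open>w\<close>. The proof runs inside out: \<open>?C3\<close> down to
  \<open>?C0\<close> are the contexts with three down to no quantifiers open.\<close>

lemma uncode_imp: "deriv L \<Gamma> (Imp (bex D Vb (bex D Va (uncode \<theta> \<psi>))) (bex D Vc \<psi>))"
proof (rule deriv.ImpI)
  \<comment> \<open>The goal as it reads below \<open>k\<close> open quantifiers.\<close>
  let ?G = "\<lambda>k. bex D Vc (pl1 0 (k + 1) \<psi>)"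
  have sG: "sub shift (?G k) = ?G (Suc k)" for k
  proof -
    have "sub (up shift) (pl1 0 (k + 1) \<psi>) = pl1 0 (Suc k + 1) \<psi>"
      unfolding pl1_def up_ren by (rule sub_ren_cong) (simp split: nat.splits)
    then show ?thesis by (simp add: sub_bex[OF un(1,4)])
  qed
  have G0: "?G 0 = bex D Vc \<psi>"
  proof -
    have "pl1 0 1 \<psi> = sub Var \<psi>"
      unfolding pl1_def by (rule sub_cong) (simp split: nat.splits)
    then show ?thesis by simp
  qed
  let ?at = "\<lambda>k. sub (\<lambda>_. Var k)"
  let ?C3 = "insert (?at 2 D) (insert (?at 2 Vb) (insert (?at 1 D) (insert (?at 1 Va)
    (insert (pl3 1 2 0 \<theta>) (insert (pl1 0 3 \<psi>) \<Gamma>)))))"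
  have sub3: "\<Gamma> \<subseteq> ?C3" by blast
  \<comment> \<open>Here \<open>y\<close>, \<open>x\<close>, \<open>z\<close> are the variables 2,
    1, 0. Binding \<open>y\<close> and \<open>x\<close> again, with themselves as witnesses, gives
    the left side of the definability equivalence at \<open>z\<close>.\<close>
  have "deriv L ?C3 (bex D Vb (bex D Va (pl3 0 1 2 \<theta>)))"
  proof (rule bexI[of _ _ 2])
    have "sub (inst (Var 2)) (bex D Va (pl3 0 1 2 \<theta>)) = bex D Va (pl3 0 3 1 \<theta>)"
    proof -
      have "sub (up (inst (Var 2))) (pl3 0 1 2 \<theta>) = pl3 0 3 1 \<theta>"
        unfolding pl3_def
        by (rule sub_ren_cong)
          (simp add: inst_Var up_ren numeral_2_eq_2 numeral_3_eq_3 split: nat.splits)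
      then show ?thesis by (simp add: sub_bex[OF un(1,2)])
    qed
    moreover have "deriv L ?C3 (bex D Va (pl3 0 3 1 \<theta>))"
    proof (rule bexI[of _ _ 1])
      have "sub (inst (Var 1)) (pl3 0 3 1 \<theta>) = pl3 1 2 0 \<theta>"
        unfolding pl3_def
        by (rule sub_ren_cong)
          (simp add: inst_Var numeral_2_eq_2 numeral_3_eq_3 split: nat.splits)
      then show "deriv L ?C3 (sub (inst (Var 1)) (pl3 0 3 1 \<theta>))"
        by (simp add: fm deriv.Assm)
    qed (simp_all add: fm un deriv.Assm)
    ultimately show "deriv L ?C3 (sub (inst (Var 2)) (bex D Va (pl3 0 1 2 \<theta>)))"
      by simp
  qed (simp_all add: fm un deriv.Assm)
  then have Eq: "deriv L ?C3 (bex D Vc (Eq (Var (Suc 0)) (Var 0)))"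
    using inst_def_iff[OF sub3, of 0] by (simp only: add_0)
  have C3: "deriv L ?C3 (?G 3)"
  proof (rule bexE[OF Eq])
    let ?C4 = "insert (?at 0 D) (insert (?at 0 Vc) (insert (Eq (Var (Suc 0)) (Var 0))
      (sub shift ` ?C3)))"
    \<comment> \<open>Now \<open>w\<close> is variable 0 and \<open>z\<close> is variable 1. The
      offset 5 counts the four open quantifiers and the place to be instantiated, so that
      \<open>EqSubst\<close> can replace \<open>z\<close> by \<open>w\<close>.\<close>
    have "deriv L ?C4 (sub (inst (Var (Suc 0))) (pl1 0 5 \<psi>))"
      using inst_pl1[of "Suc 0" 4 \<psi>] by (simp add: fm shift_pl1 deriv.Assm)
    then have "deriv L ?C4 (sub (inst (Var 0)) (pl1 0 5 \<psi>))"
      by (rule deriv.EqSubst[rotated]) (simp add: deriv.Assm)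
    then have "deriv L ?C4 (?G 4)"
      by (intro bexI[of _ _ 0]) (simp_all add: fm un deriv.Assm)
    then show "deriv L ?C4 (sub shift (?G 3))"
      by (simp only: sG) simp
  qed (simp_all add: fm un)
  let ?C2 = "insert (?at 1 D) (insert (?at 1 Vb) (insert (?at 0 D) (insert (?at 0 Va)
    (insert (uncode \<theta> \<psi>) \<Gamma>))))"
  have C2: "deriv L ?C2 (?G 2)"
  proof (rule ExE)
    have "deriv L ?C2 (And (And (Eq (Var 0) (Var 0)) (Eq (Var 1) (Var 1)))
        (Ex (And (pl3 1 2 0 \<theta>) (pl1 0 3 \<psi>))))"
      by (rule deriv.Assm) (simp_all add: fm uncode_def)
    from AndE2[OF this]
    show "deriv L ?C2 (Ex (And (pl3 1 2 0 \<theta>) (pl1 0 3 \<psi>)))"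
      by (simp add: fm)
    let ?E = "And (pl3 1 2 0 \<theta>) (pl1 0 3 \<psi>)"
    let ?C = "insert ?E (sub shift ` ?C2)"
    have E: "deriv L ?C ?E"
      by (rule deriv.Assm) (simp_all add: fm)
    have 1: "deriv L ?C (pl3 1 2 0 \<theta>)" and 2: "deriv L ?C (pl1 0 3 \<psi>)"
      by (rule AndE1[OF E] AndE2[OF E]; simp add: fm)+
    have "sub shift (?at 1 B) = ?at 2 B" "sub shift (?at 0 B) = ?at 1 B" for B
      by (simp_all add: sub_ren numeral_2_eq_2)
    then have "deriv L (insert (pl3 1 2 0 \<theta>) (insert (pl1 0 3 \<psi>) ?C)) (?G 3)"
      using \<Gamma> by (intro deriv_mono[OF C3]) auto
    then have "deriv L ?C (Imp (pl1 0 3 \<psi>) (Imp (pl3 1 2 0 \<theta>) (?G 3)))"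
      by (intro deriv.ImpI) (simp_all add: fm)
    from deriv.ImpE[OF deriv.ImpE[OF this 2] 1]
    show "deriv L ?C (sub shift (?G 2))"
      by (simp only: sG) simp
  qed (simp_all add: fm)
  let ?C1 = "insert (?at 0 D) (insert (?at 0 Vb) (insert (bex D Va (uncode \<theta> \<psi>)) \<Gamma>))"
  have C1: "deriv L ?C1 (?G 1)"
  proof (rule bexE)
    show "deriv L ?C1 (bex D Va (uncode \<theta> \<psi>))"
      by (rule deriv.Assm) (simp_all add: fm)
    have "sub shift (?at 0 B) = ?at 1 B" for B
      by (simp add: sub_ren)
    then have "deriv L (insert (?at 0 D) (insert (?at 0 Va) (insert (uncode \<theta> \<psi>)
        (sub shift ` ?C1)))) (?G 2)"
      using \<Gamma> by (intro deriv_mono[OF C2]) auto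
    then show "deriv L (insert (?at 0 D) (insert (?at 0 Va) (insert (uncode \<theta> \<psi>)
        (sub shift ` ?C1)))) (sub shift (?G 1))"
      by (simp only: sG Suc_1)
  qed (simp_all add: fm un)
  let ?C0 = "insert (bex D Vb (bex D Va (uncode \<theta> \<psi>))) \<Gamma>"
  have "deriv L ?C0 (?G 0)"
  proof (rule bexE)
    show "deriv L ?C0 (bex D Vb (bex D Va (uncode \<theta> \<psi>)))"
      by (rule deriv.Assm) (simp_all add: fm)
    have "deriv L (insert (?at 0 D) (insert (?at 0 Vb) (insert (bex D Va (uncode \<theta> \<psi>))
        (sub shift ` ?C0)))) (?G 1)"
      using \<Gamma> by (intro deriv_mono[OF C1]) auto
    then show "deriv L (insert (?at 0 D) (insert (?at 0 Vb) (insert (bex D Va (uncode \<theta> \<psi>))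
        (sub shift ` ?C0)))) (sub shift (?G 0))"
      by (simp only: sG) simp
  qed (simp_all add: fm un)
  then show "deriv L ?C0 (bex D Vc \<psi>)"
    by (simp only: G0)
qed (simp add: fm)

text \<open>Let \<open>w\<close> be a value of the numeral of \<open>c\<close> with \<psi>(w). Then
  \<open>w = w\<close> is an instance of the right side of definability, whose left side supplies
  \<open>y\<close> and \<open>x\<close> with \<theta>(x, y, w). So \<open>w\<close> is the code
  demanded by \<open>uncode\<close>.\<close>

lemma imp_uncode: "deriv L \<Gamma> (Imp (bex D Vc \<psi>) (bex D Vb (bex D Va (uncode \<theta> \<psi>))))"
proof (rule deriv.ImpI)
  \<comment> \<open>Variables 0 and 1 are bound by the two outer quantifiers and stay; the others
    are raised by \<open>k\<close>, the number of quantifiers already open.\<close>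
  let ?r = "\<lambda>k i. case i of 0 \<Rightarrow> 0 | Suc j \<Rightarrow> (case j of 0 \<Rightarrow> 1 | Suc l \<Rightarrow> l + k + 2)"
  let ?U = "\<lambda>k. sub (\<lambda>i. Var (?r k i)) (uncode \<theta> \<psi>)"
  let ?G = "\<lambda>k. bex D Vb (bex D Va (?U k))"
  have sG: "sub shift (?G k) = ?G (Suc k)" for k
  proof -
    have "sub (up (up shift)) (?U k) = ?U (Suc k)"
      unfolding up_ren by (rule sub_ren_cong) (simp split: nat.splits)
    then show ?thesis by (simp add: sub_bex[OF un(1)] un)
  qed
  have G0: "?G 0 = bex D Vb (bex D Va (uncode \<theta> \<psi>))"
  proof -
    have "?U 0 = sub Var (uncode \<theta> \<psi>)"
      by (rule sub_cong) (simp split: nat.splits)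
    then show ?thesis by simp
  qed
  let ?at = "\<lambda>k. sub (\<lambda>_. Var k)"
  let ?C3 = "insert (?at 1 D) (insert (?at 1 Vb) (insert (?at 0 D) (insert (?at 0 Va)
    (insert (pl3 0 1 2 \<theta>) (insert (pl1 2 3 \<psi>) \<Gamma>)))))"
  have C3: "deriv L ?C3 (?G 3)"
  proof (rule bexI[of _ _ 1])
    have "sub (inst (Var 1)) (bex D Va (?U 3)) = bex D Va (sub (up (inst (Var 1))) (?U 3))"
      by (simp add: sub_bex un)
    moreover have "deriv L ?C3 (bex D Va (sub (up (inst (Var 1))) (?U 3)))"
    proof (rule bexI[of _ _ 0])
      let ?s = "\<lambda>i. case i of 0 \<Rightarrow> 0 | Suc j \<Rightarrow> (case j of 0 \<Rightarrow> 1 | Suc l \<Rightarrow> l + 3)"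
      have "sub (inst (Var 0)) (sub (up (inst (Var 1))) (?U 3)) =
          sub (\<lambda>i. Var (?s i)) (uncode \<theta> \<psi>)"
        unfolding inst_Var up_ren sub_ren by (rule sub_cong) (simp split: nat.splits)
      moreover have "sub (up (\<lambda>i. Var (?s i))) (pl3 1 2 0 \<theta>) = pl3 1 2 0 \<theta>"
        unfolding pl3_def up_ren
        by (rule sub_ren_cong) (simp add: numeral_2_eq_2 split: nat.splits)
      moreover have "sub (up (\<lambda>i. Var (?s i))) (pl1 0 3 \<psi>) = pl1 0 4 \<psi>"
        unfolding pl1_def up_ren
        by (rule sub_ren_cong) (simp add: numeral_3_eq_3 split: nat.splits)
      ultimately have eq: "sub (inst (Var 0)) (sub (up (inst (Var 1))) (?U 3)) =
          And (And (Eq (Var 0) (Var 0)) (Eq (Var 1) (Var 1))) (Ex (And (pl3 1 2 0 \<theta>) (pl1 0 4 \<psi>)))"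
        by (simp add: uncode_def)
      \<comment> \<open>\<open>w\<close> was opened first and lies below \<open>y\<close> and
        \<open>x\<close>, so it is now variable 2.\<close>
      have "sub (inst (Var 2)) (pl3 1 2 0 \<theta>) = pl3 0 1 2 \<theta>"
        unfolding pl3_def
        by (rule sub_ren_cong) (simp add: inst_Var numeral_2_eq_2 split: nat.splits)
      moreover have "sub (inst (Var 2)) (pl1 0 4 \<psi>) = pl1 2 3 \<psi>"
        using inst_pl1[of 2 3 \<psi>] by simp
      ultimately have "deriv L ?C3 (Ex (And (pl3 1 2 0 \<theta>) (pl1 0 4 \<psi>)))"
        by (intro ExI[of _ _ "Var 2"]) (simp_all add: AndI deriv.Assm fm)
      then show "deriv L ?C3 (sub (inst (Var 0)) (sub (up (inst (Var 1))) (?U 3)))"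
        unfolding eq by (intro AndI deriv.EqRefl) (simp_all add: fm)
    qed (simp_all add: fm un deriv.Assm inst_Var up_ren)
    ultimately show "deriv L ?C3 (sub (inst (Var 1)) (bex D Va (?U 3)))"
      by simp
  qed (simp_all add: fm un deriv.Assm)
  have shift_at: "sub shift (?at k B) = ?at (Suc k) B" for k B
    by (simp add: sub_ren)
  let ?C2 = "insert (?at 0 D) (insert (?at 0 Vb) (insert (bex D Va (pl3 0 1 2 \<theta>))
    (insert (pl1 1 2 \<psi>) \<Gamma>)))"
  have C2: "deriv L ?C2 (?G 2)"
  proof (rule bexE)
    show "deriv L ?C2 (bex D Va (pl3 0 1 2 \<theta>))"
      by (rule deriv.Assm) (simp_all add: fm)
    have "deriv L (insert (?at 0 D) (insert (?at 0 Va) (insert (pl3 0 1 2 \<theta>)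
        (sub shift ` ?C2)))) (?G 3)"
      using \<Gamma> by (intro deriv_mono[OF C3])
        (auto simp: shift_at shift_pl1 numeral_2_eq_2 numeral_3_eq_3)
    then show "deriv L (insert (?at 0 D) (insert (?at 0 Va) (insert (pl3 0 1 2 \<theta>)
        (sub shift ` ?C2)))) (sub shift (?G 2))"
      by (simp only: sG Suc_numeral add_num_simps)
  qed (simp_all add: fm un)
  let ?C1 = "insert (?at 0 D) (insert (?at 0 Vc) (insert (pl1 0 1 \<psi>) \<Gamma>))"
  have C1: "deriv L ?C1 (?G 1)"
  proof (rule bexE)
    have sub1: "\<Gamma> \<subseteq> ?C1" by blast
    \<comment> \<open>Variable 0, that is \<open>w\<close>, serves both as the value and as the
      witness for the numeral of \<open>c\<close>.\<close>
    have "deriv L ?C1 (bex D Vc (Eq (Var (Suc 0)) (Var 0)))"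
    proof (rule bexI[of _ _ 0])
      have "deriv L ?C1 (Eq (Var 0) (Var 0))"
        by (rule deriv.EqRefl) simp
      then show "deriv L ?C1 (sub (inst (Var 0)) (Eq (Var (Suc 0)) (Var 0)))"
        by (simp add: inst_def)
    qed (simp_all add: fm un deriv.Assm)
    then show "deriv L ?C1 (bex D Vb (bex D Va (pl3 0 1 2 \<theta>)))"
      using inst_def_iff[OF sub1, of 0] by (simp only: add_0)
    have "deriv L (insert (?at 0 D) (insert (?at 0 Vb) (insert (bex D Va (pl3 0 1 2 \<theta>))
        (sub shift ` ?C1)))) (?G 2)"
      using \<Gamma> by (intro deriv_mono[OF C2]) (auto simp: shift_pl1 numeral_2_eq_2)
    then show "deriv L (insert (?at 0 D) (insert (?at 0 Vb) (insert (bex D Va (pl3 0 1 2 \<theta>))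
        (sub shift ` ?C1)))) (sub shift (?G 1))"
      by (simp only: sG Suc_1)
  qed (simp_all add: fm un)
  let ?C0 = "insert (bex D Vc \<psi>) \<Gamma>"
  have "deriv L ?C0 (?G 0)"
  proof (rule bexE)
    show "deriv L ?C0 (bex D Vc \<psi>)"
      by (rule deriv.Assm) (simp_all add: fm)
    have "pl1 0 1 \<psi> = sub Var \<psi>"
      unfolding pl1_def by (rule sub_cong) (simp split: nat.splits)
    then have "deriv L (insert (?at 0 D) (insert (?at 0 Vc) (insert \<psi>
        (sub shift ` ?C0)))) (?G 1)"
      using \<Gamma> by (intro deriv_mono[OF C1]) auto
    then show "deriv L (insert (?at 0 D) (insert (?at 0 Vc) (insert \<psi>
        (sub shift ` ?C0)))) (sub shift (?G 0))"
      using sG[of 0] by (simp only: One_nat_def)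
  qed (simp_all add: fm un)
  then show "deriv L ?C0 (bex D Vb (bex D Va (uncode \<theta> \<psi>)))"
    by (simp only: G0)
qed (simp add: fm)

end

section \<open>Plugging in numerals\<close>

lemma fv_num:
  assumes I: "is_transl I (lang_of Num) L"
  shows "fm_in L (dom_at I 0)" "fv (dom_at I 0) \<subseteq> {0}"
    "fm_in L (val I (num a))" "fv (val I (num a)) \<subseteq> {0}"
proof -
  have D: "fm_in L (domI I)" "fv (domI I) \<subseteq> {0}"
    and Z: "fm_in L (funI I (0, 0))" "fv (funI I (0, 0)) \<subseteq> {0}"
    and S: "fm_in L (funI I (1, 1))" "fv (funI I (1, 1)) \<subseteq> {..1}"
    using I by (auto simp: is_transl_def Num_def)
  show D0: "fm_in L (dom_at I 0)" "fv (dom_at I 0) \<subseteq> {0}"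
    using D by (auto simp: dom_at_def)
  \<comment> \<open>Brings the substitution inside \<open>bind_args\<close> into the form of a
    renaming, so that \<open>fv_ren\<close> and \<open>fm_in_ren\<close> apply.\<close>
  have ren: "(\<lambda>i. case i of 0 \<Rightarrow> Var 0 | Suc m \<Rightarrow> Var (k m)) =
      (\<lambda>i. Var (case i of 0 \<Rightarrow> 0 | Suc m \<Rightarrow> k m))" for k
    by (auto simp: fun_eq_iff split: nat.splits)
  have "fm_in L (val I (num a)) \<and> fv (val I (num a)) \<subseteq> {0}"
  proof (induction a)
    case 0
    then show ?case using Z by (simp add: bind_args_def Exs_def Conjs_def)
  next
    case (Suc a)
    have "Suc i \<notin> fv (dom_at I 0)" "Suc (Suc i) \<notin> fv (funI I (1, 1))" for i
      using D0 S by auto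
    moreover have "Suc i \<notin> fv (sub (\<lambda>i. Var (case i of 0 \<Rightarrow> 0 | Suc m \<Rightarrow> Suc (Suc m)))
        (val I (num a)))" for i
      using Suc unfolding fv_ren by (auto split: nat.splits)
    ultimately show ?case using Suc D0 S
      by (auto simp: bind_args_def Exs_def Conjs_def ren)
  qed
  then show "fm_in L (val I (num a))" "fv (val I (num a)) \<subseteq> {0}"
    by auto
qed

lemma plug_Cons: "plug I A (a # as) = plug I (bex (dom_at I 0) (val I (num a)) A) as"
  by (simp add: bex_def)

text \<open>\<open>plug\<close> works from the inside out: each numeral adds a quantifier to the
  formula before the next one is plugged in. Hence the induction is general in \<open>A\<close> and
  \<open>B\<close>.\<close>

lemma plug_mono:
  assumes "is_transl I (lang_of Num) L" "sub shift ` \<Gamma> = \<Gamma>"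
    and "deriv L \<Gamma> (Imp A B)" "fm_in L A" "fm_in L B"
  shows "deriv L \<Gamma> (Imp (plug I A as) (plug I B as))"
  using assms(3-5)
proof (induction as arbitrary: A B)
  case (Cons a as)
  note num = fv_num[OF assms(1)]
  show ?case
    unfolding plug_Cons
    by (rule Cons.IH) (simp_all add: bex_mono[OF Cons.prems(1) assms(2)] num Cons.prems)
qed simp

lemma fm_in_plug:
  assumes "is_transl I (lang_of Num) L" "fm_in L A"
  shows "fm_in L (plug I A as)"
  using assms(2)
proof (induction as arbitrary: A)
  case (Cons a as)
  show ?case
    unfolding plug_Cons by (rule Cons.IH) (simp add: fv_num[OF assms(1)] Cons.prems)
qed simp

lemma contrapos:
  assumes "deriv L \<Gamma> (Imp A B)" "deriv L \<Gamma> (Neg B)" "fm_in L A"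
  shows "deriv L \<Gamma> (Neg A)"
proof (rule deriv.ImpI[OF assms(3)])
  let ?\<Delta> = "insert A \<Gamma>"
  have "deriv L ?\<Delta> (Imp A B)" "deriv L ?\<Delta> (Neg B)"
    using assms deriv_mono by blast+
  then show "deriv L ?\<Delta> Bot"
    using assms(3) by (meson deriv.Assm deriv.ImpE insertI1)
qed

section \<open>Recursive decoding\<close>

inductive_cases ev_ZeroE: "ev Zero xs y"
inductive_cases ev_SuccE: "ev Succ xs y"
inductive_cases ev_ProjE: "ev (Proj i) xs y"
inductive_cases ev_CompE: "ev (Comp f gs) xs y"
inductive_cases ev_PRec0E: "ev (PRec f g) (0 # xs) y"
inductive_cases ev_PRecSucE: "ev (PRec f g) (Suc m # xs) y"
inductive_cases ev_MuE: "ev (Mu f) xs y"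

text \<open>Needed for the converse in \<open>RE_code2\<close>: if the composed scheme converges,
  its inner schemes must have returned exactly the decoded arguments.\<close>

lemma ev_det: "ev f xs y \<Longrightarrow> ev f xs z \<Longrightarrow> y = z"
proof (induction arbitrary: z rule: ev.induct)
  case (1 xs)
  then show ?case by - (erule ev_ZeroE; simp)
next
  case (2 x)
  then show ?case by - (erule ev_SuccE; simp)
next
  case (3 i xs)
  then show ?case by - (erule ev_ProjE; simp)
next
  case (4 xs gs ys f y)
  from "4.prems" obtain zs where zs: "list_all2 (\<lambda>g. ev g xs) gs zs" "ev f zs z"
    by (rule ev_CompE)
  have "ys = zs"
  proof (rule nth_equalityI)
    show "length ys = length zs"
      using list_all2_lengthD[OF "4.IH"(1)] list_all2_lengthD[OF zs(1)] by simp
    show "ys ! i = zs ! i" if "i < length ys" for i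
      using list_all2_nthD2[OF "4.IH"(1) that] list_all2_nthD2[OF zs(1), of i] that
        list_all2_lengthD[OF "4.IH"(1)] list_all2_lengthD[OF zs(1)] by simp
  qed
  then show ?case using "4.IH"(2)[of z] zs(2) by simp
next
  case (5 f xs y g)
  from "5.prems" show ?case by (rule ev_PRec0E) (rule "5.IH")
next
  case (6 f g m xs y y')
  from "6.prems" obtain w where "ev (PRec f g) (m # xs) w" "ev g (m # w # xs) z"
    by (rule ev_PRecSucE)
  then show ?case using "6.IH"(1)[of w] "6.IH"(2)[of z] by simp
next
  case (7 f m xs)
  from "7.prems" have "ev f (z # xs) 0 \<and> (\<forall>i<z. \<exists>y. ev f (i # xs) (Suc y))"
    by (rule ev_MuE) blast
  then have z: "ev f (z # xs) 0" "\<forall>i<z. \<exists>y. ev f (i # xs) (Suc y)"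
    by simp_all
  show ?case
  proof (cases m z rule: linorder_cases)
    case less
    then obtain y where "ev f (m # xs) (Suc y)" using z(2) by blast
    then show ?thesis using "7.IH"(1)[of "Suc y"] by simp
  next
    case greater
    then show ?thesis using "7.IH"(2) z(1) by fastforce
  qed
qed

section \<open>Schemes for decidable tests and search\<close>

lemma ev_Proj: "i < length xs \<Longrightarrow> y = xs ! i \<Longrightarrow> ev (Proj i) xs y"
  by (simp add: ev.intros)

lemma ev_Comp1: "ev g xs y \<Longrightarrow> ev f [y] z \<Longrightarrow> ev (Comp f [g]) xs z"
  by (rule ev.intros(4)[of xs _ "[y]"]) auto

lemma ev_Comp2:
  "ev g xs y \<Longrightarrow> ev g' xs y' \<Longrightarrow> ev f [y, y'] z \<Longrightarrow> ev (Comp f [g, g']) xs z"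
  by (rule ev.intros(4)[of xs _ "[y, y']"]) auto

lemma ev_Comp3:
  "ev g xs y \<Longrightarrow> ev g' xs y' \<Longrightarrow> ev g'' xs y'' \<Longrightarrow> ev f [y, y', y''] z \<Longrightarrow>
    ev (Comp f [g, g', g'']) xs z"
  by (rule ev.intros(4)[of xs _ "[y, y', y'']"]) auto

text \<open>Truth is coded by 0 because \<open>Mu\<close> searches for a zero; convergence is
  included since \<open>Mu\<close> also evaluates the failing candidates.\<close>

definition tests :: "recf \<Rightarrow> nat list \<Rightarrow> bool \<Rightarrow> bool" where
  "tests f xs P \<longleftrightarrow> (\<exists>y. ev f xs y \<and> (y = 0 \<longleftrightarrow> P))"

definition "one_rf = Comp Succ [Zero]"
definition "pred_rf = PRec Zero (Proj 0)"
text \<open>\<open>PRec\<close> recurses on its first argument, so truncated subtraction takes the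
  subtrahend first.\<close>

definition "rsub_rf = PRec (Proj 0) (Comp pred_rf [Proj 1])"
definition "conj_rf = PRec (Proj 0) (Comp one_rf [Zero])"
definition "disj_rf = PRec Zero (Proj 2)"

lemma ev_one: "ev one_rf xs 1"
  using ev_Comp1[OF ev.intros(1) ev.intros(2)] by (simp add: one_rf_def)

lemma ev_pred: "ev pred_rf [m] (m - 1)"
proof (induction m)
  case (Suc m)
  have "ev (Proj 0) [m, m - 1] m"
    by (rule ev_Proj) auto
  then show ?case
    using ev.intros(6)[OF Suc[unfolded pred_rf_def]] unfolding pred_rf_def by simp
qed (simp add: pred_rf_def ev.intros)

lemma ev_rsub: "ev rsub_rf [m, x] (x - m)"
proof (induction m)
  case 0
  then show ?case
    unfolding rsub_rf_def using ev.intros(5)[OF ev_Proj[of 0 "[x]" x]] by simp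
next
  case (Suc m)
  have "ev (Comp pred_rf [Proj 1]) [m, x - m, x] (x - Suc m)"
    using ev_Comp1[OF ev_Proj ev_pred, of 1 "[m, x - m, x]" "x - m"] by simp
  then show ?case
    using Suc unfolding rsub_rf_def by (rule ev.intros(6)[rotated])
qed

lemma ev_conj: "ev conj_rf [m, x] (if m = 0 then x else 1)"
proof (induction m)
  case 0
  then show ?case
    unfolding conj_rf_def using ev.intros(5)[OF ev_Proj[of 0 "[x]" x]] by simp
next
  case (Suc m)
  have "ev (Comp one_rf [Zero]) ys 1" for ys
    by (rule ev_Comp1[OF ev.intros(1) ev_one])
  then show ?case
    using ev.intros(6)[OF Suc[unfolded conj_rf_def]] unfolding conj_rf_def by simp
qed

lemma ev_disj: "ev disj_rf [m, x] (if m = 0 then 0 else x)"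
proof (induction m)
  case 0
  then show ?case
    unfolding disj_rf_def by (simp add: ev.intros)
next
  case (Suc m)
  have "ev (Proj 2) [m, y, x] x" for y
    by (rule ev_Proj) auto
  then show ?case
    using ev.intros(6)[OF Suc[unfolded disj_rf_def]] unfolding disj_rf_def by simp
qed

text \<open>Two numbers are equal iff both truncated differences vanish.\<close>

definition "eq_rf f g =
  Comp conj_rf [Comp rsub_rf [f, g], Comp rsub_rf [g, f]]"

lemma tests_eq:
  assumes "ev f xs x" "ev g xs y"
  shows "tests (eq_rf f g) xs (x = y)"
proof -
  have "ev (eq_rf f g) xs (if y - x = 0 then x - y else 1)"
    unfolding eq_rf_def
    by (intro ev_Comp2[OF ev_Comp2[OF assms] ev_Comp2[OF assms(2,1)] ev_conj] ev_rsub)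
  then show ?thesis
    unfolding tests_def by (intro exI[of _ "if y - x = 0 then x - y else 1"]) auto
qed

lemma tests_Comp3:
  "ev g xs y \<Longrightarrow> ev g' xs y' \<Longrightarrow> ev g'' xs y'' \<Longrightarrow> tests f [y, y', y''] P \<Longrightarrow>
    tests (Comp f [g, g', g'']) xs P"
  unfolding tests_def by (elim exE conjE) (intro exI conjI ev_Comp3, assumption+)

text \<open>Bounded search by recursion on the bound, starting from the empty disjunction, which is
  false and hence 1. In the step the arguments are the candidate, the previous result and two
  parameters.\<close>

definition "bex_rf f = PRec one_rf (Comp disj_rf [Proj 1, Comp f [Proj 0, Proj 2, Proj 3]])"

lemma tests_bex:
  assumes "\<And>i. tests f [i, x, y] (P i)"
  shows "tests (bex_rf f) [m, x, y] (\<exists>i<m. P i)"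
proof (induction m)
  case 0
  have "ev (bex_rf f) [0, x, y] 1"
    unfolding bex_rf_def by (rule ev.intros(5)[OF ev_one])
  then show ?case
    unfolding tests_def by (intro exI[of _ 1]) simp
next
  case (Suc m)
  then obtain r where r: "ev (bex_rf f) [m, x, y] r" "r = 0 \<longleftrightarrow> (\<exists>i<m. P i)"
    by (auto simp: tests_def)
  obtain s where s: "ev f [m, x, y] s" "s = 0 \<longleftrightarrow> P m"
    using assms by (auto simp: tests_def)
  let ?xs = "[m, r, x, y]"
  have "ev (Comp f [Proj 0, Proj 2, Proj 3]) ?xs s"
    by (rule ev_Comp3[OF _ _ _ s(1)]; rule ev_Proj) (auto simp: numeral_3_eq_3)
  then have "ev (Comp disj_rf [Proj 1, Comp f [Proj 0, Proj 2, Proj 3]]) ?xs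
      (if r = 0 then 0 else s)"
    by (intro ev_Comp2[OF _ _ ev_disj] ev_Proj) auto
  then have "ev (bex_rf f) [Suc m, x, y] (if r = 0 then 0 else s)"
    using r(1) unfolding bex_rf_def by (rule ev.intros(6)[rotated])
  then show ?case
    unfolding tests_def
    using r(2) s(2) by (intro exI[of _ "if r = 0 then 0 else s"]) (auto simp: less_Suc_eq)
qed

text \<open>\<open>Mu\<close> returns the least witness: below it every test converges to a nonzero
  value, hence to a successor, as its rule requires.\<close>

lemma ev_Mu_tests:
  assumes "\<And>i. tests f (i # xs) (P i)" "P k"
  shows "\<exists>m. ev (Mu f) xs m \<and> P m"
proof (intro exI conjI)
  let ?m = "LEAST i. P i"
  show Pm: "P ?m"
    using assms(2) by (rule LeastI)
  have "\<exists>y. ev f (i # xs) (Suc y)" if i: "i < ?m" for i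
  proof -
    obtain y where "ev f (i # xs) y" "y \<noteq> 0"
      using assms(1)[of i] not_less_Least[OF i] by (auto simp: tests_def)
    then show ?thesis by (cases y) auto
  qed
  moreover have "ev f (?m # xs) 0"
    using assms(1)[of ?m] Pm by (auto simp: tests_def)
  ultimately show "ev (Mu f) xs ?m"
    by (intro ev.intros(7) allI impI)
qed

section \<open>Inverting the pairing function\<close>

lemma bij_pairing:
  assumes "bij (\<lambda>(a, b). J a b)"
  shows "J a b = J a' b' \<longleftrightarrow> a = a' \<and> b = b'" "\<exists>a b. c = J a b"
proof -
  show "J a b = J a' b' \<longleftrightarrow> a = a' \<and> b = b'"
    using inj_eq[OF bij_is_inj[OF assms], of "(a, b)" "(a', b')"] by simp
  obtain p where "c = (case p of (a, b) \<Rightarrow> J a b)"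
    using bij_is_surj[OF assms] unfolding surj_def by blast
  then show "\<exists>a b. c = J a b"
    by (cases p) auto
qed

text \<open>
  No bound on the preimage of \<open>c\<close> is known. Hence first search for some \<open>N\<close> such that both
  components lie below \<open>N\<close>; this turns the quantifier over the other component into a bounded one.
\<close>

lemma recursive2_inverse:
  assumes "recursive2 J" "bij (\<lambda>(a, b). J a b)"
  obtains K1 K2 where "\<And>a b. ev K1 [J a b] a" "\<And>a b. ev K2 [J a b] b"
proof -
  obtain j where j: "ev j [a, b] (J a b)" for a b
    using assms(1) by (auto simp: recursive2_def)
  note inj = bij_pairing(1)[OF assms(2)]

  \<comment> \<open>The component to be searched for comes first, as \<open>bex_rf\<close> and
    \<open>Mu\<close> expect.\<close>
  define t where "t = eq_rf (Comp j [Proj 1, Proj 0]) (Proj 2)"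
  have t: "tests t [b, a, c] (J a b = c)" for a b c
    unfolding t_def by (intro tests_eq ev_Comp2[OF _ _ j] ev_Proj) auto
  define tb where "tb = Comp (bex_rf t) [Proj 1, Proj 0, Proj 2]"
  have tb: "tests tb [a, N, c] (\<exists>b<N. J a b = c)" for a N c
    unfolding tb_def by (rule tests_Comp3[OF _ _ _ tests_bex[OF t]]; rule ev_Proj) auto
  define tab where "tab = Comp (bex_rf tb) [Proj 0, Proj 0, Proj 1]"
  have tab: "tests tab [N, c] (\<exists>a<N. \<exists>b<N. J a b = c)" for N c
    unfolding tab_def by (rule tests_Comp3[OF _ _ _ tests_bex[OF tb]]; rule ev_Proj) auto

  define K1 where "K1 = Comp (Mu tb) [Mu tab, Proj 0]"
  have K1: "ev K1 [J a b] a" for a b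
  proof -
    \<comment> \<open>Some bound exists, so the search for \<open>N\<close> ends; by injectivity the
      \<open>N\<close> found exceeds both true components.\<close>
    have "\<exists>a'<Suc (max a b). \<exists>b'<Suc (max a b). J a' b' = J a b"
      by (intro exI conjI) (auto simp: less_Suc_eq_le)
    from ev_Mu_tests[OF tab this]
    obtain N where N: "ev (Mu tab) [J a b] N" "\<exists>a'<N. \<exists>b'<N. J a' b' = J a b"
      by blast
    then have "\<exists>b'<N. J a b' = J a b"
      by (auto simp: inj)
    from ev_Mu_tests[OF tb this]
    obtain a' where a': "ev (Mu tb) [N, J a b] a'" "\<exists>b'<N. J a' b' = J a b"
      by blast
    then have "a' = a"
      by (auto simp: inj)
    then show ?thesis
      unfolding K1_def using a'(1) by (intro ev_Comp2[OF N(1)] ev_Proj) auto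
  qed
  \<comment> \<open>Once the first component is known, the second is the only solution of an
    unbounded search.\<close>
  define K2 where "K2 = Comp (Mu t) [K1, Proj 0]"
  have "ev K2 [J a b] b" for a b
  proof -
    obtain b' where b': "ev (Mu t) [a, J a b] b'" "J a b' = J a b"
      using ev_Mu_tests[where P = "\<lambda>i. J a i = J a b", OF t refl] by blast
    then have "b' = b"
      by (simp add: inj)
    then show ?thesis
      unfolding K2_def using b'(1) by (intro ev_Comp2[OF K1] ev_Proj) auto
  qed
  with K1 show ?thesis
    using that by blast
qed

section \<open>Coded relations\<close>

lemma RE_length: "RE k M \<Longrightarrow> xs \<in> M \<Longrightarrow> length xs = k"
  by (simp add: RE_def)

definition code2 :: "(nat \<Rightarrow> nat \<Rightarrow> nat) \<Rightarrow> nat list \<Rightarrow> nat list" where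
  "code2 J xs = J (xs ! 0) (xs ! 1) # drop 2 xs"

text \<open>Decode the first argument and run the scheme for \<open>M\<close>. Since the pairing is
  onto and decoding always converges, this converges exactly on the codes of members of
  \<open>M\<close>.\<close>

lemma RE_code2:
  assumes J: "recursive2 J" "bij (\<lambda>(a, b). J a b)" and M: "RE (n + 1) M" and n: "n \<ge> 1"
  shows "RE n (code2 J ` M)"
proof -
  obtain f where len: "\<And>xs. xs \<in> M \<Longrightarrow> length xs = n + 1"
    and f: "\<And>xs. length xs = n + 1 \<Longrightarrow> xs \<in> M \<longleftrightarrow> (\<exists>y. ev f xs y)"
    using M unfolding RE_def by blast
  obtain K1 K2 where K: "\<And>a b. ev K1 [J a b] a" "\<And>a b. ev K2 [J a b] b"
    using recursive2_inverse[OF J] by blast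
  \<comment> \<open>Two decoded components and the \<open>n - 1\<close> remaining arguments make
    \<open>n + 1\<close> arguments.\<close>
  define gs where "gs = Comp K1 [Proj 0] # Comp K2 [Proj 0] # map Proj [1..<n]"
  have "xs \<in> code2 J ` M \<longleftrightarrow> (\<exists>y. ev (Comp f gs) xs y)" if xs: "length xs = n" for xs
  proof -
    obtain c r where cr: "xs = c # r"
      using xs n by (cases xs) auto
    obtain a b where ab: "c = J a b"
      using bij_pairing(2)[OF J(2)] by blast
    have "xs \<in> code2 J ` M \<longleftrightarrow> a # b # r \<in> M"
    proof
      assume "xs \<in> code2 J ` M"
      then obtain zs where zs: "zs \<in> M" "xs = code2 J zs" by blast
      then obtain a' b' r' where "zs = a' # b' # r'"
        using len[of zs] n by (cases zs; cases "tl zs") auto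
      then show "a # b # r \<in> M"
        using zs bij_pairing(1)[OF J(2)] by (auto simp: code2_def cr ab)
    next
      assume "a # b # r \<in> M"
      then show "xs \<in> code2 J ` M"
        by (rule image_eqI[rotated]) (simp add: code2_def cr ab)
    qed
    also have "\<dots> \<longleftrightarrow> (\<exists>y. ev f (a # b # r) y)"
      using f xs cr by simp
    also have "\<dots> \<longleftrightarrow> (\<exists>y. ev (Comp f gs) xs y)"
    proof -
      have "ev (Proj (Suc i)) xs (r ! i)" if "i < length r" for i
        using that by (intro ev_Proj) (auto simp: cr)
      then have "list_all2 (\<lambda>g. ev g xs) (map Proj [1..<n]) r"
        using xs by (auto simp: list_all2_conv_all_nth cr)
      moreover have "ev (Proj 0) xs (J a b)"
        by (rule ev_Proj) (simp_all add: cr ab)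
      ultimately have gs: "list_all2 (\<lambda>g. ev g xs) gs (a # b # r)"
        unfolding gs_def using K by (auto intro: ev_Comp1)
      have unique: "ys = a # b # r" if "list_all2 (\<lambda>g. ev g xs) gs ys" for ys
      proof (rule nth_equalityI)
        show len: "length ys = length (a # b # r)"
          using that gs by (auto dest!: list_all2_lengthD)
        fix i assume "i < length ys"
        then have "ev (gs ! i) xs (ys ! i)" "ev (gs ! i) xs ((a # b # r) ! i)"
          using list_all2_nthD2[OF that] list_all2_nthD2[OF gs] len by auto
        then show "ys ! i = (a # b # r) ! i"
          by (rule ev_det)
      qed
      have "ev f (a # b # r) y" if "ev (Comp f gs) xs y" for y
        using that by (rule ev_CompE) (frule unique, simp)
      then show ?thesis
        using ev.intros(4)[OF gs] by blast
    qed
    finally show ?thesis .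
  qed
  moreover have "length xs = n" if xs: "xs \<in> code2 J ` M" for xs
  proof -
    obtain zs where "zs \<in> M" "xs = code2 J zs"
      using xs by blast
    then show ?thesis
      using len[of zs] n by (simp add: code2_def)
  qed
  ultimately show ?thesis
    unfolding RE_def by (intro conjI ballI exI[of _ "Comp f gs"] allI impI)
qed

text \<open>Injectivity lets images commute with set difference. Lists of length at least 2 are
  those whose first two entries \<open>code2\<close> can read.\<close>

lemma inj_on_code2:
  assumes "bij (\<lambda>(a, b). J a b)"
  shows "inj_on (code2 J) {xs. length xs \<ge> 2}"
proof (rule inj_onI)
  fix xs ys :: "nat list"
  assume *: "xs \<in> {xs. length xs \<ge> 2}" "ys \<in> {xs. length xs \<ge> 2}" "code2 J xs = code2 J ys"
  obtain a b r where xs: "xs = a # b # r"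
    using *(1) by (cases xs; cases "tl xs") auto
  obtain a' b' r' where ys: "ys = a' # b' # r'"
    using *(2) by (cases ys; cases "tl ys") auto
  show "xs = ys"
    using *(3) bij_pairing(1)[OF assms, of a b a' b'] by (simp add: xs ys code2_def)
qed

text \<open>The axioms are sentences, so the set of axioms is invariant under shifts and
  \<open>coding\<close> applies. The remaining numerals \<open>as\<close> are then plugged into the
  implications by \<open>plug_mono\<close>.\<close>

lemma plug_uncode:
  assumes T: "is_thy T" and I: "is_transl I (lang_of Num) (lang_of T)"
    and fm: "fm_in (lang_of T) \<theta>" "fm_in (lang_of T) \<psi>" and fv: "fv \<theta> \<subseteq> {0, 1, 2}"
    and def: "T \<turnstile> All (Iff (plug I \<theta> [a, b]) (plug I (Eq (Var 1) (Var 0)) [c]))"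
  shows "T \<turnstile> Imp (plug I (uncode \<theta> \<psi>) (a # b # as)) (plug I \<psi> (c # as))"
    and "T \<turnstile> Imp (plug I \<psi> (c # as)) (plug I (uncode \<theta> \<psi>) (a # b # as))"
proof -
  note num = fv_num[OF I]
  have "sub shift A = A" if "A \<in> axs T" for A
    using T that by (auto simp: is_thy_def sentence_def intro: sub_closed)
  then have \<Gamma>: "sub shift ` axs T = axs T"
    by simp
  interpret coding "lang_of T" "axs T" "dom_at I 0" "val I (num a)" "val I (num b)"
    "val I (num c)" \<theta> \<psi>
    by unfold_locales (use def in \<open>simp_all only: \<Gamma> num fm fv proves_def plug_Cons plug.simps(1)\<close>)
  show "T \<turnstile> Imp (plug I (uncode \<theta> \<psi>) (a # b # as)) (plug I \<psi> (c # as))"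
    unfolding proves_def plug_Cons
    by (rule plug_mono[OF I \<Gamma> uncode_imp]) (simp_all add: fm)
  show "T \<turnstile> Imp (plug I \<psi> (c # as)) (plug I (uncode \<theta> \<psi>) (a # b # as))"
    unfolding proves_def plug_Cons
    by (rule plug_mono[OF I \<Gamma> imp_uncode]) (simp_all add: fm)
qed

theorem theorem7p1:
  fixes T :: thy and I :: transl and J2 :: "nat \<Rightarrow> nat \<Rightarrow> nat" and n :: nat
  assumes J2_bij: "bij (\<lambda>(a, b). J2 a b)"
    and J2_rec: "recursive2 J2"
    and T_thy: "is_thy T"
    and T_RE: "RE_thy T"
    and T_cons: "consistent T"
    and n: "n \<ge> 1"
    and I_interp: "interprets I Num T"
    and J2_def: "strongly_definable2 T I J2"
    and T_Rosser: "Rosser n T I"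
  shows "Rosser (n + 1) T I"
  unfolding Rosser_def
proof (intro allI impI, elim conjE)
  fix M1 M2
  assume M: "RE (n + 1) M1" "RE (n + 1) M2"
  have I: "is_transl I (lang_of Num) (lang_of T)"
    using I_interp by (simp add: interprets_def)
  obtain \<theta> where \<theta>: "fm_in (lang_of T) \<theta>" "fv \<theta> \<subseteq> {0, 1, 2}"
    "\<And>a b. T \<turnstile> All (Iff (plug I \<theta> [a, b]) (plug I (Eq (Var 1) (Var 0)) [J2 a b]))"
    using J2_def unfolding strongly_definable2_def by blast
  let ?code = "code2 J2"
  have "RE n (?code ` M1)" "RE n (?code ` M2)"
    using RE_code2[OF J2_rec J2_bij _ n] M by blast+
  then obtain \<psi> where \<psi>:
    "strongly_separates T I n \<psi> (?code ` M1 - ?code ` M2) (?code ` M2 - ?code ` M1)"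
    using T_Rosser unfolding Rosser_def by blast
  then have fm_\<psi>: "fm_in (lang_of T) \<psi>" and fv_\<psi>: "fv \<psi> = {..<n}"
    by (simp_all add: strongly_separates_def)
  have len: "length xs = n + 1" if "xs \<in> M1 \<union> M2" for xs
    using that RE_length[OF M(1)] RE_length[OF M(2)] by (elim UnE) simp_all
  have "M1 \<union> M2 \<subseteq> {xs. length xs \<ge> 2}"
    by (rule subsetI) (use len n in simp)
  then have "inj_on ?code (M1 \<union> M2)"
    by (rule inj_on_subset[OF inj_on_code2[OF J2_bij]])
  note image_diff = inj_on_image_set_diff[OF this]
  \<comment> \<open>Rosser separation of the coded relations concerns differences of images; these
    must be images of the differences for separation to carry back.\<close>
  have diff: "?code ` M1 - ?code ` M2 = ?code ` (M1 - M2)"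
    "?code ` M2 - ?code ` M1 = ?code ` (M2 - M1)"
    by (rule image_diff[symmetric]; blast)+
  have imp: "T \<turnstile> Imp (plug I (uncode \<theta> \<psi>) as) (plug I \<psi> (?code as))"
    "T \<turnstile> Imp (plug I \<psi> (?code as)) (plug I (uncode \<theta> \<psi>) as)" if as: "as \<in> M1 \<union> M2" for as
  proof -
    obtain a b r where "as = a # b # r"
      using len[OF as] n by (cases as; cases "tl as") auto
    then show "T \<turnstile> Imp (plug I (uncode \<theta> \<psi>) as) (plug I \<psi> (?code as))"
      "T \<turnstile> Imp (plug I \<psi> (?code as)) (plug I (uncode \<theta> \<psi>) as)"
      using plug_uncode[OF T_thy I \<theta>(1) fm_\<psi> \<theta>(2) \<theta>(3), of a b r] by (simp_all add: code2_def)
  qed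
  have "strongly_separates T I (n + 1) (uncode \<theta> \<psi>) (M1 - M2) (M2 - M1)"
    unfolding strongly_separates_def
  proof (intro conjI ballI)
    show "fm_in (lang_of T) (uncode \<theta> \<psi>)"
      by (simp add: \<theta>(1) fm_\<psi>)
    show "fv (uncode \<theta> \<psi>) = {..<n + 1}"
      by (rule fv_uncode[OF \<theta>(2) fv_\<psi> n])
  next
    fix as assume as: "as \<in> M1 - M2"
    then have "T \<turnstile> plug I \<psi> (?code as)"
      using \<psi> by (simp add: strongly_separates_def diff)
    moreover have "T \<turnstile> Imp (plug I \<psi> (?code as)) (plug I (uncode \<theta> \<psi>) as)"
      using as by (intro imp) simp
    ultimately show "T \<turnstile> plug I (uncode \<theta> \<psi>) as"
      unfolding proves_def by (rule deriv.ImpE[rotated])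
  next
    fix as assume as: "as \<in> M2 - M1"
    then have neg: "T \<turnstile> Neg (plug I \<psi> (?code as))"
      using \<psi> by (simp add: strongly_separates_def diff)
    \<comment> \<open>Refutability transfers by contraposition, so the negative case uses the
      implication opposite to that of the positive case.\<close>
    have "T \<turnstile> Imp (plug I (uncode \<theta> \<psi>) as) (plug I \<psi> (?code as))"
      using as by (intro imp) simp
    moreover have "fm_in (lang_of T) (plug I (uncode \<theta> \<psi>) as)"
      by (rule fm_in_plug[OF I]) (simp add: \<theta>(1) fm_\<psi>)
    ultimately show "T \<turnstile> Neg (plug I (uncode \<theta> \<psi>) as)"
      using neg contrapos unfolding proves_def by blast
  qed
  then show "\<exists>\<phi>. strongly_separates T I (n + 1) \<phi> (M1 - M2) (M2 - M1)"
    by blast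
qed

end
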